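(* Assume in addition to the setting in the context that $g$ is $\mu$-strongly convex ($\mu>0$), and let $\mathbf z_*$ be the solution of the variational inequality. If $p\in(0,1)$, $\alpha=1-p$ and $\tau=\frac{\sqrt p}{2L}$ in extragradient with variance reduction (described in the context), then for every $k\ge0$ $$\mathbb E\|\mathbf z_k-\mathbf z_*\|^2\le\left(\frac{1}{1+c/3}\right)^k\frac{2}{1-p}\|\mathbf z_0-\mathbf z_*\|^2,\qquad c=\min\left\{\frac{3p}{8},\frac{\sqrt p\,\mu}{2L}\right\}.$$
   Context: Let $\mathcal Z$ be a finite-dimensional vector space with Euclidean inner product $\langle\cdot,\cdot\rangle$ and norm $\|\cdot\|$. Let $g:\mathcal Z\to\mathbb R\cup\{+\infty\}$ be proper convex lower semicontinuous, with $\operatorname{dom} g=\{\mathbf z: g(\mathbf z)<+\infty\}$ and $\operatorname{prox}_g(\mathbf x)=\operatorname{argmin}_{\mathbf y}\{g(\mathbf y)+\frac12\|\mathbf y-\mathbf x\|^2\}$. Problem (variational inequality): find $\mathbf z_*\in\mathcal Z$ such that $\langle F(\mathbf z_* ),\mathbf z-\mathbf z_*\rangle+g(\mathbf z)-g(\mathbf z_* )\ge 0$ for all $\mathbf z\in\mathcal Z$. The solution set is assumed nonempty. The operator $F$ is monotone: $\langle F(\mathbf x)-F(\mathbf y),\mathbf x-\mathbf y\rangle\ge 0$ for all $\mathbf x,\mathbf y\in\operatorname{dom} g$. It has a stochastic oracle $F_\xi:\mathcal Z\to\mathcal Z$, where $\xi$ is random with distribution $Q$, that is unbiased, $F(\mathbf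 z)=\mathbb E[F_\xi(\mathbf z)]$, and $L$-Lipschitz in mean ($L>0$): $\mathbb E\|F_\xi(\mathbf u)-F_\xi(\mathbf v)\|^2\le L^2\|\mathbf u-\mathbf v\|^2$ for all $\mathbf u,\mathbf v\in\mathcal Z$. Extragradient with variance reduction: given $p$, $\alpha\in(0,1)$, $\tau>0$ and deterministic $\mathbf z_0=\mathbf w_0$, for $k=0,1,\dots$: set $\bar{\mathbf z}_k=\alpha\mathbf z_k+(1-\alpha)\mathbf w_k$; $\mathbf z_{k+1/2}=\operatorname{prox}_{\tau g}(\bar{\mathbf z}_k-\tau F(\mathbf w_k))$; draw $\xi_k\sim Q$ (independently of the past); $\mathbf z_{k+1}=\operatorname{prox}_{\tau g}(\bar{\mathbf z}_k-\tau[F(\mathbf w_k)+F_{\xi_k}(\mathbf z_{k+1/2})-F_{\xi_k}(\mathbf w_k)])$; $\mathbf w_{k+1}=\mathbf z_{k+1}$ with probability $p$ and $\mathbf w_{k+1}=\mathbf w_k$ with probability $1-p$ (independently of everything else). *)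

theory Defs
  imports "HOL-Probability.Probability"
begin

definition edom :: "('a \<Rightarrow> ereal) \<Rightarrow> 'a set" where
  "edom g = {z. g z < \<infinity>}"

definition proper_fun :: "('a \<Rightarrow> ereal) \<Rightarrow> bool" where
  "proper_fun g \<longleftrightarrow> (\<forall>z. g z \<noteq> -\<infinity>) \<and> edom g \<noteq> {}"

definition lsc_fun :: "('a::topological_space \<Rightarrow> ereal) \<Rightarrow> bool" where
  "lsc_fun g \<longleftrightarrow> (\<forall>x. g x \<le> Liminf (at x) g)"

text \<open>
  In \<^typ>\<open>ereal\<close> we have \<open>0 * \<infinity> = 0\<close>, so the endpoints \<open>t = 0\<close> and \<open>t = 1\<close> are harmless below.
\<close>

definition convex_fun :: "('a::real_vector \<Rightarrow> ereal) \<Rightarrow> bool" where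
  "convex_fun g \<longleftrightarrow> (\<forall>x y. \<forall>t\<in>{0..1::real}.
     g ((1 - t) *\<^sub>R x + t *\<^sub>R y) \<le> ereal (1 - t) * g x + ereal t * g y)"

definition strongly_convex_fun :: "real \<Rightarrow> ('a::real_normed_vector \<Rightarrow> ereal) \<Rightarrow> bool" where
  "strongly_convex_fun \<mu> g \<longleftrightarrow> (\<forall>x y. \<forall>t\<in>{0..1::real}.
     g ((1 - t) *\<^sub>R x + t *\<^sub>R y) + ereal (\<mu> / 2 * t * (1 - t) * (norm (x - y))\<^sup>2)
       \<le> ereal (1 - t) * g x + ereal t * g y)"

definition prox :: "('a::real_normed_vector \<Rightarrow> ereal) \<Rightarrow> 'a \<Rightarrow> 'a" where
  "prox g x = arg_min (\<lambda>y. g y + ereal (1 / 2 * (norm (y - x))\<^sup>2)) (\<lambda>_. True)"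

text \<open>
  For proper \<open>g\<close> this forces \<open>zs \<in> edom g\<close>: if \<open>g zs = \<infinity>\<close>, the left-hand side
  is \<open>-\<infinity>\<close> at every \<open>z \<in> edom g\<close>.
\<close>

definition vi_solution :: "('a::real_inner \<Rightarrow> 'a) \<Rightarrow> ('a \<Rightarrow> ereal) \<Rightarrow> 'a \<Rightarrow> bool" where
  "vi_solution F g zs \<longleftrightarrow> (\<forall>z. ereal (F zs \<bullet> (z - zs)) + g z - g zs \<ge> 0)"

definition eg_avg :: "real \<Rightarrow> 'a::real_vector \<Rightarrow> 'a \<Rightarrow> 'a" where
  "eg_avg \<alpha> z w = \<alpha> *\<^sub>R z + (1 - \<alpha>) *\<^sub>R w"

definition eg_half ::
  "('a::real_normed_vector \<Rightarrow> ereal) \<Rightarrow> ('a \<Rightarrow> 'a) \<Rightarrow> real \<Rightarrow> real \<Rightarrow> 'a \<Rightarrow> 'a \<Rightarrow> 'a" where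
  "eg_half g F \<tau> \<alpha> z w = prox (\<lambda>y. ereal \<tau> * g y) (eg_avg \<alpha> z w - \<tau> *\<^sub>R F w)"

text \<open>The argument \<open>H\<close> is the sampled operator \<open>F_\<xi>\<close> of the current iteration.\<close>

definition eg_next ::
  "('a::real_normed_vector \<Rightarrow> ereal) \<Rightarrow> ('a \<Rightarrow> 'a) \<Rightarrow> real \<Rightarrow> real \<Rightarrow> ('a \<Rightarrow> 'a) \<Rightarrow> 'a \<Rightarrow> 'a \<Rightarrow> 'a" where
  "eg_next g F \<tau> \<alpha> H z w =
     prox (\<lambda>y. ereal \<tau> * g y)
       (eg_avg \<alpha> z w - \<tau> *\<^sub>R (F w + H (eg_half g F \<tau> \<alpha> z w) - H w))"

text \<open>
  Extragradient with variance reduction, run on a sequence \<open>s\<close> of samples and a sequence \<open>b\<close> of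
  coin flips; the \<open>k\<close>-th value is the pair \<open>(z_k, w_k)\<close>.
\<close>

primrec eg_vr ::
  "('a::real_normed_vector \<Rightarrow> ereal) \<Rightarrow> ('a \<Rightarrow> 'a) \<Rightarrow> ('s \<Rightarrow> 'a \<Rightarrow> 'a) \<Rightarrow> real \<Rightarrow> real \<Rightarrow> 'a
     \<Rightarrow> (nat \<Rightarrow> 's) \<Rightarrow> (nat \<Rightarrow> bool) \<Rightarrow> nat \<Rightarrow> 'a \<times> 'a" where
  "eg_vr g F Fo \<tau> \<alpha> z0 s b 0 = (z0, z0)"
| "eg_vr g F Fo \<tau> \<alpha> z0 s b (Suc k) =
     (let (z, w) = eg_vr g F Fo \<tau> \<alpha> z0 s b k;
          z' = eg_next g F \<tau> \<alpha> (Fo (s k)) z w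
      in (z', if b k then z' else w))"

text \<open>
  \<open>\<xi> k\<close> has law \<open>Q\<close>, \<open>b k\<close> is a Bernoulli(\<open>p\<close>) coin, and all these variables together are mutually
  independent: the pairs \<open>(\<xi> k, b k)\<close> are independent over \<open>k\<close>, and the law of each pair is the
  product of its two marginals. (The library's \<open>indep_var\<close> needs both variables to have values in
  the same type, so the independence within a pair is expressed by the joint law.)
\<close>

definition sampling :: "'w measure \<Rightarrow> 's measure \<Rightarrow> real \<Rightarrow> (nat \<Rightarrow> 'w \<Rightarrow> 's) \<Rightarrow> (nat \<Rightarrow> 'w \<Rightarrow> bool) \<Rightarrow> bool"
  where
  "sampling M Q p \<xi> b \<longleftrightarrow>
     prob_space.indep_vars M (\<lambda>_. Q \<Otimes>\<^sub>M measure_pmf (bernoulli_pmf p)) (\<lambda>k \<omega>. (\<xi> k \<omega>, b k \<omega>)) UNIV \<and>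
     (\<forall>k. distr M (Q \<Otimes>\<^sub>M measure_pmf (bernoulli_pmf p)) (\<lambda>\<omega>. (\<xi> k \<omega>, b k \<omega>))
            = Q \<Otimes>\<^sub>M measure_pmf (bernoulli_pmf p))"

end

theory Submission
  imports Defs
begin

text \<open>
  The Lyapunov function of a state \<open>(z, w)\<close> is
  \<open>V = (1 - p) * (norm (z - zs))\<^sup>2 + (norm (w - zs))\<^sup>2\<close>. One iteration contracts its conditional
  expectation by the factor \<open>1 / (1 + c / 3)\<close>; iterating over independent draws and comparing
  \<open>V\<close> with the squared error at both ends gives the rate.

  The contraction has a deterministic and a probabilistic half. Write \<open>y\<close> for the half step, \<open>z'\<close> for
  the new iterate and \<open>H\<close> for the sampled operator. Adding the variational inequalities of the two
  prox steps gives a descent inequality (\<open>eg_step_descent\<close>) whose left-hand side carries the gain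
  \<open>\<tau> * \<mu> * (norm (z' - zs))\<^sup>2\<close> from strong convexity, and whose right-hand side carries the variance
  term \<open>2 * \<tau>\<^sup>2 * (norm (H y - H w))\<^sup>2\<close> and the operator term at \<open>y\<close>. Half of the negative term
  \<open>p * (norm (y - w))\<^sup>2\<close> is reserved for the variance; the other half, together with
  \<open>(norm (z' - y))\<^sup>2 / 2\<close>, shows that the old anchor \<open>w\<close> is close to \<open>z'\<close>, so that the gain on
  \<open>z'\<close> also yields a gain on the anchor (\<open>eg_step_lyapunov\<close>).

  In expectation (\<open>eg_step_expectation\<close>) the step size, for which \<open>4 * \<tau>\<^sup>2 * L\<^sup>2 = p\<close>, makes the
  reserved half cover the variance, and the operator term is nonpositive because the sampled direction
  is unbiased for \<open>F y\<close>, \<open>F\<close> is monotone and \<open>zs\<close> solves the variational inequality. Since the state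
  after \<open>k\<close> steps is a measurable function of the first \<open>k\<close> draws, whose joint law is a product
  measure (\<open>sampling_distr\<close>), the bound can be integrated over the past (\<open>eg_path_expectation\<close>).

  The analytic prerequisite is that the prox map is well defined and satisfies its variational
  inequality (\<open>prox_properties\<close>), which rests on the existence of minimisers of strongly convex lower
  semicontinuous functions (\<open>strongly_convex_attains_min\<close>).
\<close>

section \<open>Minimisers of strongly convex functions\<close>

lemma lsc_fun_eventually_gt:
  assumes "lsc_fun f" and "C < f x"
  shows "\<forall>\<^sub>F y in nhds x. C < f y"
proof -
  have "C < Liminf (at x) f"
    using assms by (auto simp: lsc_fun_def intro: less_le_trans)
  then have "\<forall>\<^sub>F y in at x. C < f y"
    by (rule less_LiminfD)
  then show ?thesis
    using assms(2) by (auto simp: eventually_at_filter elim!: eventually_mono)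
qed

text \<open>
  If no point of \<open>K\<close> is a minimiser, the open sets \<open>{y. f x < f y}\<close> for \<open>x \<in> K\<close> cover \<open>K\<close>; in a
  finite subcover, the centre with the smallest value of \<open>f\<close> is left uncovered.
\<close>

lemma lsc_fun_attains_min_on_compact:
  fixes f :: "'a::topological_space \<Rightarrow> ereal"
  assumes lsc: "lsc_fun f" and K: "compact K" "K \<noteq> {}"
  shows "\<exists>x\<in>K. \<forall>y\<in>K. f x \<le> f y"
proof (rule ccontr)
  assume "\<not> ?thesis"
  then have cover: "K \<subseteq> (\<Union>x\<in>K. {y. f x < f y})"
    by (force simp: not_le)
  have "open {y. f x < f y}" for x
    unfolding open_subopen[of "{y. f x < f y}"]
    using lsc_fun_eventually_gt[OF lsc] by (fastforce simp: eventually_nhds)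
  then obtain K' where K': "K' \<subseteq> K" "finite K'" "K \<subseteq> (\<Union>x\<in>K'. {y. f x < f y})"
    using compactE_image[OF K(1) _ cover] by metis
  then have "K' \<noteq> {}" using K by auto
  then obtain x where "x \<in> K'" "\<And>y. y \<in> K' \<Longrightarrow> \<not> f y < f x"
    using arg_min_if_finite[OF K'(2), of f] by metis
  then show False using K' by blast
qed

text \<open>
  Coercivity comes from strong convexity: on the unit ball around a point \<open>a\<close> of the domain, \<open>f\<close> is
  bounded below by some \<open>m\<close>. Along any ray from \<open>a\<close>, strong convexity compares the value at
  distance \<open>1\<close> (at least \<open>m\<close>) with those at \<open>a\<close> and at distance \<open>r\<close>, and this pushes \<open>f\<close> above
  \<open>f a\<close> as soon as \<open>r > 1 + 2 * (f a - m) / \<nu>\<close>. So it suffices to minimise over a compact ball.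
\<close>

lemma strongly_convex_attains_min:
  fixes f :: "'a::euclidean_space \<Rightarrow> ereal"
  assumes pr: "proper_fun f" and lsc: "lsc_fun f"
    and sc: "strongly_convex_fun \<nu> f" and \<nu>: "\<nu> > 0"
  shows "\<exists>q. \<forall>y. f q \<le> f y"
proof -
  obtain a where a: "f a < \<infinity>" using pr by (auto simp: proper_fun_def edom_def)
  have nmi: "f y \<noteq> -\<infinity>" for y using pr by (auto simp: proper_fun_def)
  obtain fa where fa: "f a = ereal fa" using a nmi[of a] by (cases "f a") auto
  obtain m0 where m0: "\<And>y. y \<in> cball a 1 \<Longrightarrow> f m0 \<le> f y"
    using lsc_fun_attains_min_on_compact[OF lsc compact_cball, of a 1] by fastforce
  have "f m0 \<le> f a" by (rule m0) simp
  then obtain m where m: "f m0 = ereal m" using fa nmi[of m0] by (cases "f m0") auto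
  with \<open>f m0 \<le> f a\<close> fa have ma: "m \<le> fa" by simp
  define R where "R = 1 + 2 * (fa - m) / \<nu>"
  have R: "R \<ge> 1" using ma \<nu> by (simp add: R_def)
  have far: "f a \<le> f y" if y: "y \<notin> cball a R" for y
  proof (cases "f y")
    case (real fy)
    define r where "r = norm (y - a)"
    have r: "r > R" using y by (simp add: r_def dist_norm norm_minus_commute)
    have r1: "r > 1" using r R by simp
    define u where "u = (1 - 1 / r) *\<^sub>R a + (1 / r) *\<^sub>R y"
    have "u - a = (1 / r) *\<^sub>R (y - a)"
      by (simp add: u_def algebra_simps)
    then have "norm (u - a) = 1" using r1 by (auto simp: r_def)
    then have "f m0 \<le> f u" by (intro m0) (simp add: dist_norm norm_minus_commute)
    moreover have "f u + ereal (\<nu> / 2 * (1 / r) * (1 - 1 / r) * (norm (a - y))\<^sup>2)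
        \<le> ereal (1 - 1 / r) * f a + ereal (1 / r) * f y"
      unfolding u_def
      using sc[unfolded strongly_convex_fun_def, rule_format, of "1 / r" a y] r1 by simp
    ultimately have "m + \<nu> / 2 * (1 / r) * (1 - 1 / r) * r\<^sup>2 \<le> (1 - 1 / r) * fa + (1 / r) * fy"
      using m fa real by (cases "f u") (auto simp: r_def norm_minus_commute)
    also have "\<nu> / 2 * (1 / r) * (1 - 1 / r) * r\<^sup>2 = \<nu> / 2 * (r - 1)"
      using r1 by (simp add: field_simps power2_eq_square)
    finally have "r * (m + \<nu> / 2 * (r - 1)) \<le> r * ((1 - 1 / r) * fa + (1 / r) * fy)"
      using r1 by (intro mult_left_mono) auto
    also have "\<dots> = (r - 1) * fa + fy" using r1 by (simp add: field_simps)
    finally have 1: "r * (m - fa + \<nu> / 2 * (r - 1)) \<le> fy - fa" by (simp add: algebra_simps)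
    have "fa - m \<le> \<nu> / 2 * (r - 1)"
      using r \<nu> by (simp add: R_def field_simps)
    then have "0 \<le> r * (m - fa + \<nu> / 2 * (r - 1))" using r1 by simp
    with 1 show ?thesis by (simp add: fa real)
  qed (use nmi in auto)
  have "cball a R \<noteq> {}" using R by simp
  then obtain q where q: "\<And>y. y \<in> cball a R \<Longrightarrow> f q \<le> f y"
    using lsc_fun_attains_min_on_compact[OF lsc compact_cball] by blast
  have "f q \<le> f y" for y
    using q[of y] far[of y] q[of a] R by fastforce
  then show ?thesis by blast
qed

text \<open>
  Comparing the minimiser \<open>q\<close> with the point at parameter \<open>t\<close> on the segment to \<open>u\<close> and dividing by
  \<open>t\<close> gives the bound with \<open>\<nu>\<close> replaced by \<open>\<nu> * (1 - t)\<close>; then \<open>t\<close> tends to \<open>0\<close>.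
\<close>

lemma strongly_convex_min_growth:
  fixes f :: "'a::real_normed_vector \<Rightarrow> ereal"
  assumes sc: "strongly_convex_fun \<nu> f"
    and q: "\<And>y. f q \<le> f y" and fq: "f q = ereal a" and fu: "f u = ereal c"
  shows "a + \<nu> / 2 * (norm (u - q))\<^sup>2 \<le> c"
proof -
  have step: "a + \<nu> / 2 * (1 - t) * (norm (u - q))\<^sup>2 \<le> c" if t: "0 < t" "t < 1" for t
  proof -
    let ?v = "(1 - t) *\<^sub>R q + t *\<^sub>R u"
    have "f ?v + ereal (\<nu> / 2 * t * (1 - t) * (norm (q - u))\<^sup>2)
        \<le> ereal (1 - t) * f q + ereal t * f u"
      using sc t by (auto simp: strongly_convex_fun_def)
    with q[of ?v] have "a + \<nu> / 2 * t * (1 - t) * (norm (u - q))\<^sup>2 \<le> (1 - t) * a + t * c"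
      using fq fu by (cases "f ?v") (auto simp: norm_minus_commute)
    then have "t * (a + \<nu> / 2 * (1 - t) * (norm (u - q))\<^sup>2) \<le> t * c"
      by (simp add: algebra_simps)
    then show ?thesis using t by simp
  qed
  have "((\<lambda>t. a + \<nu> / 2 * (1 - t) * (norm (u - q))\<^sup>2) \<longlongrightarrow> a + \<nu> / 2 * (1 - 0) * (norm (u - q))\<^sup>2)
      (at_right 0)"
    by (intro tendsto_intros)
  moreover have "\<forall>\<^sub>F t in at_right (0::real). a + \<nu> / 2 * (1 - t) * (norm (u - q))\<^sup>2 \<le> c"
    unfolding eventually_at_right_field using step by (intro exI[of _ 1]) auto
  ultimately show ?thesis
    using tendsto_upperbound by fastforce
qed

lemma norm_sq_convex_combination:
  fixes x y :: "'a::real_inner"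
  shows "(norm ((1 - t) *\<^sub>R x + t *\<^sub>R y))\<^sup>2 + t * (1 - t) * (norm (x - y))\<^sup>2
    = (1 - t) * (norm x)\<^sup>2 + t * (norm y)\<^sup>2"
  by (simp add: power2_norm_eq_inner algebra_simps inner_commute)

lemma prox_objective_strongly_convex:
  fixes g :: "'a::real_inner \<Rightarrow> ereal"
  assumes pr: "proper_fun g" and sc: "strongly_convex_fun \<mu> g" and \<tau>: "\<tau> > 0"
  shows "strongly_convex_fun (1 + \<tau> * \<mu>) (\<lambda>y. ereal \<tau> * g y + ereal (1 / 2 * (norm (y - x))\<^sup>2))"
  unfolding strongly_convex_fun_def
proof (intro allI ballI)
  fix u v :: 'a and t :: real assume t: "t \<in> {0..1}"
  let ?f = "\<lambda>y. ereal \<tau> * g y + ereal (1 / 2 * (norm (y - x))\<^sup>2)"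
  let ?m = "(1 - t) *\<^sub>R u + t *\<^sub>R v"
  have nmi: "g y \<noteq> -\<infinity>" for y using pr by (auto simp: proper_fun_def)
  \<comment> \<open>At the endpoints \<open>0 * \<infinity> = 0\<close> makes the claim trivial; inside, an infinite value makes the
    right-hand side infinite.\<close>
  consider "t = 0" | "t = 1" | "0 < t" "t < 1" using t by fastforce
  then show "?f ?m + ereal ((1 + \<tau> * \<mu>) / 2 * t * (1 - t) * (norm (u - v))\<^sup>2)
      \<le> ereal (1 - t) * ?f u + ereal t * ?f v"
  proof cases
    case 3
    show ?thesis
    proof (cases "g u = \<infinity> \<or> g v = \<infinity>")
      case True
      then have "ereal (1 - t) * ?f u + ereal t * ?f v = \<infinity>"
        using 3 \<tau> nmi[of u] nmi[of v] by (cases "g u"; cases "g v") auto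
      then show ?thesis by (simp only: ereal_less_eq(1))
    next
      case False
      then obtain a b where ab: "g u = ereal a" "g v = ereal b"
        using nmi[of u] nmi[of v] by (cases "g u"; cases "g v") auto
      have sc': "g ?m + ereal (\<mu> / 2 * t * (1 - t) * (norm (u - v))\<^sup>2)
          \<le> ereal (1 - t) * g u + ereal t * g v"
        using sc t by (auto simp: strongly_convex_fun_def)
      obtain d where d: "g ?m = ereal d" using sc' ab nmi[of ?m] by (cases "g ?m") auto
      have "d + \<mu> / 2 * t * (1 - t) * (norm (u - v))\<^sup>2 \<le> (1 - t) * a + t * b"
        using sc' ab d by simp
      then have "\<tau> * (d + \<mu> / 2 * t * (1 - t) * (norm (u - v))\<^sup>2) \<le> \<tau> * ((1 - t) * a + t * b)"
        using \<tau> by simp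
      moreover have "?m - x = (1 - t) *\<^sub>R (u - x) + t *\<^sub>R (v - x)"
        by (simp add: algebra_simps)
      then have "(norm (?m - x))\<^sup>2 + t * (1 - t) * (norm (u - v))\<^sup>2
          = (1 - t) * (norm (u - x))\<^sup>2 + t * (norm (v - x))\<^sup>2"
        using norm_sq_convex_combination[of t "u - x" "v - x"] by simp
      ultimately show ?thesis
        by (simp add: ab d) (simp add: algebra_simps add_divide_distrib diff_divide_distrib)
    qed
  qed (use \<tau> in \<open>auto simp: zero_ereal_def[symmetric] one_ereal_def[symmetric]\<close>)
qed

text \<open>
  The quadratic is continuous, so a strict lower bound of the sum splits into a strict lower bound
  \<open>d\<close> of \<open>g\<close> and one of the quadratic, each of which persists near \<open>u\<close>.
\<close>

lemma prox_objective_lsc: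
  fixes g :: "'a::real_normed_vector \<Rightarrow> ereal"
  assumes pr: "proper_fun g" and lsc: "lsc_fun g" and \<tau>: "\<tau> > 0"
  shows "lsc_fun (\<lambda>y. ereal \<tau> * g y + ereal (1 / 2 * (norm (y - x))\<^sup>2))" (is "lsc_fun ?f")
  unfolding lsc_fun_def le_Liminf_iff
proof (intro allI impI)
  fix u C assume C: "C < ?f u"
  have nmi: "g y \<noteq> -\<infinity>" for y using pr by (auto simp: proper_fun_def)
  let ?q = "\<lambda>y. 1 / 2 * (norm (y - x))\<^sup>2"
  show "\<forall>\<^sub>F y in at u. C < ?f y"
  proof (cases C)
    case (real c)
    have "ereal ((c - ?q u) / \<tau>) < g u"
      using C real \<tau> by (cases "g u") (auto simp: field_simps)
    then obtain d where d: "ereal ((c - ?q u) / \<tau>) < ereal d" "ereal d < g u"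
      using ereal_dense2 by blast
    have 1: "\<forall>\<^sub>F y in at u. ereal d < g y"
      using lsc_fun_eventually_gt[OF lsc d(2)] by (auto simp: eventually_at_filter elim: eventually_mono)
    have "((\<lambda>y. \<tau> * d + ?q y) \<longlongrightarrow> \<tau> * d + ?q u) (at u)"
      by (intro tendsto_intros) 
    moreover have "c < \<tau> * d + ?q u" using d(1) \<tau> by (simp add: field_simps)
    ultimately have 2: "\<forall>\<^sub>F y in at u. c < \<tau> * d + ?q y" by (rule order_tendstoD)
    show ?thesis
      using 1 2
    proof eventually_elim
      case (elim y)
      show ?case
      proof (cases "g y")
        case (real e)
        have "\<tau> * d < \<tau> * e" using elim(1) real \<tau> by simp
        then show ?thesis using elim(2) by (simp add: real \<open>C = ereal c\<close>)
      qed (use elim \<tau> \<open>C = ereal c\<close> nmi[of y] in auto)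
    qed
  next
    case MInf
    have "-\<infinity> < ?f y" for y using \<tau> nmi[of y] by (cases "g y") auto
    then show ?thesis using MInf by simp
  qed (use C in auto)
qed

section \<open>The prox map\<close>

locale strongly_convex_lsc =
  fixes g :: "'a::euclidean_space \<Rightarrow> ereal" and \<mu> :: real
  assumes proper: "proper_fun g" and lsc: "lsc_fun g"
    and strongly: "strongly_convex_fun \<mu> g" and mu_nonneg: "\<mu> \<ge> 0"
begin

text \<open>
  The real values of \<open>g\<close>, meant on \<open>edom g\<close> only; this keeps extended reals out of the
  computations below.
\<close>

definition gr :: "'a \<Rightarrow> real" where "gr x = real_of_ereal (g x)"

lemma g_eq_gr: "x \<in> edom g \<Longrightarrow> g x = ereal (gr x)"
  using proper by (cases "g x") (auto simp: gr_def edom_def proper_fun_def)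

text \<open>
  The prox objective is strongly convex with modulus \<open>1 + \<tau> * \<mu>\<close>, so it has a minimiser and grows
  quadratically around it. Expanding \<open>u - x = (u - q) + (q - x)\<close> cancels one unit of this modulus
  against the quadratic penalty and leaves the variational inequality.
\<close>

lemma prox_properties:
  fixes x :: 'a
  assumes \<tau>: "\<tau> > 0"
  defines "q \<equiv> prox (\<lambda>y. ereal \<tau> * g y) x"
  shows prox_in_edom: "q \<in> edom g"
    and prox_variational: "u \<in> edom g \<Longrightarrow>
      (q - x) \<bullet> (u - q) + \<tau> * gr u - \<tau> * gr q \<ge> \<tau> * \<mu> / 2 * (norm (u - q))\<^sup>2"
proof -
  let ?f = "\<lambda>y. ereal \<tau> * g y + ereal (1 / 2 * (norm (y - x))\<^sup>2)"
  have sc: "strongly_convex_fun (1 + \<tau> * \<mu>) ?f"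
    by (rule prox_objective_strongly_convex[OF proper strongly \<tau>])
  obtain a where a: "a \<in> edom g" using proper by (auto simp: proper_fun_def)
  have nmi: "g y \<noteq> -\<infinity>" for y using proper by (auto simp: proper_fun_def)
  have "?f y \<noteq> -\<infinity>" for y using nmi[of y] \<tau> by (cases "g y") auto
  moreover have "?f a < \<infinity>" using a by (simp add: g_eq_gr)
  ultimately have "proper_fun ?f" unfolding proper_fun_def edom_def by blast
  moreover have "1 + \<tau> * \<mu> > 0" using mu_nonneg \<tau> by (simp add: add_pos_nonneg)
  ultimately obtain q0 where "\<And>y. ?f q0 \<le> ?f y"
    using strongly_convex_attains_min[OF _ prox_objective_lsc[OF proper lsc \<tau>] sc] by blast
  then have q: "?f q \<le> ?f y" for y
    unfolding q_def prox_def
    using arg_minI[of "\<lambda>_. True" q0 ?f "\<lambda>q. \<forall>y. ?f q \<le> ?f y"] by (simp add: not_less)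
  from q[of a] have "g q \<noteq> \<infinity>" using a \<tau> by (auto simp: g_eq_gr)
  then show 1: "q \<in> edom g" by (simp add: edom_def)
  assume u: "u \<in> edom g"
  have "\<tau> * gr q + 1 / 2 * (norm (q - x))\<^sup>2 + (1 + \<tau> * \<mu>) / 2 * (norm (u - q))\<^sup>2
      \<le> \<tau> * gr u + 1 / 2 * (norm (u - x))\<^sup>2"
    by (rule strongly_convex_min_growth[OF sc q]) (simp_all add: g_eq_gr 1 u)
  moreover have "(norm (u - x))\<^sup>2 = (norm (u - q))\<^sup>2 + 2 * ((q - x) \<bullet> (u - q)) + (norm (q - x))\<^sup>2"
    by (simp add: power2_norm_eq_inner algebra_simps inner_commute)
  ultimately show "(q - x) \<bullet> (u - q) + \<tau> * gr u - \<tau> * gr q \<ge> \<tau> * \<mu> / 2 * (norm (u - q))\<^sup>2"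
    by (simp add: algebra_simps add_divide_distrib)
qed

text \<open>
  Adding the variational inequalities of the two prox points, each tested with the other one,
  removes \<open>g\<close>. The resulting continuity of the prox map makes the iterates measurable.
\<close>

lemma prox_nonexpansive:
  assumes \<tau>: "\<tau> > 0"
  shows "norm (prox (\<lambda>y. ereal \<tau> * g y) x - prox (\<lambda>y. ereal \<tau> * g y) x') \<le> norm (x - x')"
proof -
  let ?q = "prox (\<lambda>y. ereal \<tau> * g y) x" and ?q' = "prox (\<lambda>y. ereal \<tau> * g y) x'"
  have nn: "0 \<le> \<tau> * \<mu> / 2 * (norm v)\<^sup>2" for v :: 'a
    using \<tau> mu_nonneg by simp
  have "0 \<le> (?q - x) \<bullet> (?q' - ?q) + \<tau> * gr ?q' - \<tau> * gr ?q"
    using prox_variational[OF \<tau> prox_in_edom[OF \<tau>], of x' x] nn[of "?q' - ?q"] by linarith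
  moreover have "0 \<le> (?q' - x') \<bullet> (?q - ?q') + \<tau> * gr ?q - \<tau> * gr ?q'"
    using prox_variational[OF \<tau> prox_in_edom[OF \<tau>], of x x'] nn[of "?q - ?q'"] by linarith
  ultimately have "(norm (?q - ?q'))\<^sup>2 \<le> (x - x') \<bullet> (?q - ?q')"
    by (simp add: power2_norm_eq_inner algebra_simps inner_commute)
  also have "\<dots> \<le> norm (x - x') * norm (?q - ?q')"
    by (rule norm_cauchy_schwarz)
  finally show ?thesis
    by (metis mult_right_le_imp_le norm_ge_zero order_le_less power2_eq_square)
qed

lemma borel_measurable_prox:
  assumes "\<tau> > 0"
  shows "prox (\<lambda>y. ereal \<tau> * g y) \<in> borel_measurable borel"
proof (rule borel_measurable_continuous_onI, unfold continuous_on_iff, intro ballI allI impI)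
  fix x :: 'a and e :: real assume "e > 0"
  then show "\<exists>d>0. \<forall>x'\<in>UNIV. dist x' x < d \<longrightarrow>
      dist (prox (\<lambda>y. ereal \<tau> * g y) x') (prox (\<lambda>y. ereal \<tau> * g y) x) < e"
    by (intro exI[of _ e]) (auto simp: dist_norm intro: le_less_trans[OF prox_nonexpansive[OF assms]])
qed

lemma vi_solution_real:
  assumes "vi_solution F g zs"
  shows vi_solution_in_edom: "zs \<in> edom g"
    and vi_solution_ineq: "u \<in> edom g \<Longrightarrow> F zs \<bullet> (u - zs) + gr u - gr zs \<ge> 0"
proof -
  obtain a where a: "a \<in> edom g" using proper by (auto simp: proper_fun_def)
  have vi: "ereal (F zs \<bullet> (z - zs)) + g z - g zs \<ge> 0" for z
    using assms by (simp add: vi_solution_def)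
  show 1: "zs \<in> edom g"
    using vi[of a] by (cases "g zs") (auto simp: g_eq_gr[OF a] edom_def)
  show "u \<in> edom g \<Longrightarrow> F zs \<bullet> (u - zs) + gr u - gr zs \<ge> 0"
    using vi[of u] 1 by (simp add: g_eq_gr zero_ereal_def)
qed

end

section \<open>The deterministic inequality of one step\<close>

lemma three_point:
  fixes a b c :: "'a::real_inner"
  shows "2 * ((a - b) \<bullet> (c - a)) = (norm (c - b))\<^sup>2 - (norm (a - b))\<^sup>2 - (norm (c - a))\<^sup>2"
  by (simp add: power2_norm_eq_inner algebra_simps inner_commute)

lemma norm_add_sq_le_double:
  fixes a b :: "'a::real_inner"
  shows "(norm (a + b))\<^sup>2 \<le> 2 * (norm a)\<^sup>2 + 2 * (norm b)\<^sup>2"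
  using zero_le_power2[of "norm (a - b)"]
  by (simp add: power2_norm_eq_inner algebra_simps inner_commute)

lemma inner_le_young:
  fixes a b :: "'a::real_inner"
  shows "2 * (a \<bullet> b) \<le> 2 * (norm a)\<^sup>2 + (norm b)\<^sup>2 / 2"
  using zero_le_power2[of "norm (2 *\<^sub>R a - b)"]
  by (simp add: power2_norm_eq_inner algebra_simps inner_commute)

lemma three_point_average:
  fixes a z w u :: "'a::real_inner"
  shows "2 * ((a - eg_avg \<alpha> z w) \<bullet> (u - a)) = \<alpha> * (norm (u - z))\<^sup>2 + (1 - \<alpha>) * (norm (u - w))\<^sup>2
    - \<alpha> * (norm (a - z))\<^sup>2 - (1 - \<alpha>) * (norm (a - w))\<^sup>2 - (norm (u - a))\<^sup>2"
proof -
  have "2 * ((a - eg_avg \<alpha> z w) \<bullet> (u - a))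
      = \<alpha> * (2 * ((a - z) \<bullet> (u - a))) + (1 - \<alpha>) * (2 * ((a - w) \<bullet> (u - a)))"
    by (simp add: eg_avg_def algebra_simps)
  then show ?thesis unfolding three_point by (simp add: algebra_simps)
qed

text \<open>
  The deterministic inequality of one step, for an arbitrary sample \<open>H\<close>. It is the sum of the
  variational inequality of the second prox, tested at \<open>zs\<close>, and that of the first prox, tested at
  \<open>z'\<close>: the function values at \<open>z'\<close> cancel, and the two inner products with the average become
  squared distances. The error \<open>(H y - H w) \<bullet> (y - z')\<close> of sampling is absorbed by Young's
  inequality, at the cost of half of the available \<open>(norm (z' - y))\<^sup>2\<close>.
\<close>

lemma (in strongly_convex_lsc) eg_step_descent:
  fixes z w zs :: 'a and F H :: "'a \<Rightarrow> 'a" and \<tau> \<alpha> :: real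
  defines "y \<equiv> eg_half g F \<tau> \<alpha> z w" and "z' \<equiv> eg_next g F \<tau> \<alpha> H z w"
  assumes \<tau>: "\<tau> > 0" and zs: "zs \<in> edom g"
  shows "(1 + \<tau> * \<mu>) * (norm (z' - zs))\<^sup>2 + (norm (z' - y))\<^sup>2 / 2 + (1 - \<alpha>) * (norm (y - w))\<^sup>2
      \<le> \<alpha> * (norm (z - zs))\<^sup>2 + (1 - \<alpha>) * (norm (w - zs))\<^sup>2 - \<alpha> * (norm (y - z))\<^sup>2
        + 2 * \<tau>\<^sup>2 * (norm (H y - H w))\<^sup>2
        + 2 * \<tau> * ((F w + H y - H w) \<bullet> (zs - y) + gr zs - gr y)"
proof -
  define G where "G = F w + H y - H w"
  let ?a = "eg_avg \<alpha> z w"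
  have y: "y = prox (\<lambda>y. ereal \<tau> * g y) (?a - \<tau> *\<^sub>R F w)"
    by (simp add: y_def eg_half_def)
  have z': "z' = prox (\<lambda>y. ereal \<tau> * g y) (?a - \<tau> *\<^sub>R G)"
    by (simp add: z'_def eg_next_def y_def G_def)
  have "y \<in> edom g" "z' \<in> edom g"
    unfolding y z' by (intro prox_in_edom \<tau>)+
  have "\<tau> * \<mu> / 2 * (norm (zs - z'))\<^sup>2
      \<le> (z' - (?a - \<tau> *\<^sub>R G)) \<bullet> (zs - z') + \<tau> * gr zs - \<tau> * gr z'"
    unfolding z' by (rule prox_variational[OF \<tau> zs])
  moreover have "\<tau> * \<mu> / 2 * (norm (z' - y))\<^sup>2
      \<le> (y - (?a - \<tau> *\<^sub>R F w)) \<bullet> (z' - y) + \<tau> * gr z' - \<tau> * gr y"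
    unfolding y by (rule prox_variational[OF \<tau> \<open>z' \<in> edom g\<close>])
  moreover have "0 \<le> \<tau> * \<mu> / 2 * (norm (z' - y))\<^sup>2"
    using \<tau> mu_nonneg by simp
  moreover have "(z' - (?a - \<tau> *\<^sub>R G)) \<bullet> (zs - z') + (y - (?a - \<tau> *\<^sub>R F w)) \<bullet> (z' - y)
      = (z' - ?a) \<bullet> (zs - z') + (y - ?a) \<bullet> (z' - y)
        + \<tau> * (G \<bullet> (zs - y)) + (\<tau> *\<^sub>R (H y - H w)) \<bullet> (y - z')"
    by (simp add: G_def algebra_simps)
  ultimately have "\<tau> * \<mu> * (norm (z' - zs))\<^sup>2
      \<le> 2 * ((z' - ?a) \<bullet> (zs - z')) + 2 * ((y - ?a) \<bullet> (z' - y)) + 2 * ((\<tau> *\<^sub>R (H y - H w)) \<bullet> (y - z'))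
        + 2 * \<tau> * (G \<bullet> (zs - y) + gr zs - gr y)"
    by (simp add: algebra_simps norm_minus_commute)
  moreover have "2 * ((\<tau> *\<^sub>R (H y - H w)) \<bullet> (y - z'))
      \<le> 2 * \<tau>\<^sup>2 * (norm (H y - H w))\<^sup>2 + (norm (z' - y))\<^sup>2 / 2"
    using inner_le_young[of "\<tau> *\<^sub>R (H y - H w)" "y - z'"] 
    by (simp add: power_mult_distrib norm_minus_commute)
  ultimately show ?thesis
    unfolding three_point_average G_def[symmetric]
    by (simp add: norm_minus_commute algebra_simps)
qed

text \<open>
  With probability \<open>p\<close> the new anchor is \<open>z'\<close>, otherwise it stays \<open>w\<close>; so the factor after
  \<open>1 + c / 3\<close> is the mean of the Lyapunov function over the coin. The gain \<open>\<tau> * \<mu> * (norm (z' - zs))\<^sup>2\<close>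
  of the descent inequality does not control the anchor directly, but \<open>w\<close> is close to \<open>z'\<close> up to the
  leftover terms \<open>p / 2 * (norm (y - w))\<^sup>2\<close> and \<open>(norm (z' - y))\<^sup>2 / 2\<close>: this is where the
  condition \<open>c \<le> 3 * p / 8\<close> enters. The other half of \<open>p * (norm (y - w))\<^sup>2\<close> is kept to pay for the
  variance, which makes the correction in parentheses nonpositive in the mean for short steps.
\<close>

lemma (in strongly_convex_lsc) eg_step_lyapunov:
  fixes z w zs :: 'a and F H :: "'a \<Rightarrow> 'a" and \<tau> p c :: real
  defines "y \<equiv> eg_half g F \<tau> (1 - p) z w" and "z' \<equiv> eg_next g F \<tau> (1 - p) H z w"
  assumes \<tau>: "\<tau> > 0" and zs: "zs \<in> edom g" and p: "0 \<le> p" "p \<le> 1"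
    and c: "0 \<le> c" "c \<le> 3 * p / 8" "c \<le> \<tau> * \<mu>"
  shows "(1 + c / 3) * ((norm (z' - zs))\<^sup>2 + (1 - p) * (norm (w - zs))\<^sup>2)
      \<le> (1 - p) * (norm (z - zs))\<^sup>2 + (norm (w - zs))\<^sup>2
        + (2 * \<tau>\<^sup>2 * (norm (H y - H w))\<^sup>2 - p / 2 * (norm (y - w))\<^sup>2)
        + 2 * \<tau> * ((F w + H y - H w) \<bullet> (zs - y) + gr zs - gr y)"
proof -
  have desc: "(1 + \<tau> * \<mu>) * (norm (z' - zs))\<^sup>2 + (norm (z' - y))\<^sup>2 / 2 + p * (norm (y - w))\<^sup>2
      \<le> (1 - p) * (norm (z - zs))\<^sup>2 + p * (norm (w - zs))\<^sup>2 - (1 - p) * (norm (y - z))\<^sup>2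
        + 2 * \<tau>\<^sup>2 * (norm (H y - H w))\<^sup>2
        + 2 * \<tau> * ((F w + H y - H w) \<bullet> (zs - y) + gr zs - gr y)"
    using eg_step_descent[OF \<tau> zs, where F = F and H = H and \<alpha> = "1 - p" and z = z and w = w] by (simp add: y_def z'_def)
  have "(norm (w - zs))\<^sup>2 \<le> 2 * (norm (z' - zs))\<^sup>2 + 2 * (norm (w - z'))\<^sup>2"
    using norm_add_sq_le_double[of "z' - zs" "w - z'"] by (simp add: algebra_simps)
  moreover have "(norm (w - z'))\<^sup>2 \<le> 2 * (norm (y - w))\<^sup>2 + 2 * (norm (z' - y))\<^sup>2"
    using norm_add_sq_le_double[of "w - y" "y - z'"] by (simp add: norm_minus_commute)
  ultimately have W: "(norm (w - zs))\<^sup>2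
      \<le> 2 * (norm (z' - zs))\<^sup>2 + 4 * (norm (y - w))\<^sup>2 + 4 * (norm (z' - y))\<^sup>2" by linarith
  have "c / 3 * ((norm (z' - zs))\<^sup>2 + (1 - p) * (norm (w - zs))\<^sup>2)
      \<le> c / 3 * ((norm (z' - zs))\<^sup>2 + 1 * (norm (w - zs))\<^sup>2)"
    using p c by (intro mult_left_mono add_left_mono mult_right_mono) auto
  also have "\<dots> \<le> c / 3 * (3 * (norm (z' - zs))\<^sup>2 + 4 * (norm (y - w))\<^sup>2 + 4 * (norm (z' - y))\<^sup>2)"
    using W c by (intro mult_left_mono) auto
  also have "\<dots> = c * (norm (z' - zs))\<^sup>2 + 4 * c / 3 * (norm (y - w))\<^sup>2 + 4 * c / 3 * (norm (z' - y))\<^sup>2"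
    by (simp add: algebra_simps)
  also have "\<dots> \<le> \<tau> * \<mu> * (norm (z' - zs))\<^sup>2 + p / 2 * (norm (y - w))\<^sup>2 + 1 / 2 * (norm (z' - y))\<^sup>2"
    using c p by (intro add_mono mult_right_mono) auto
  finally have "c / 3 * ((norm (z' - zs))\<^sup>2 + (1 - p) * (norm (w - zs))\<^sup>2)
      \<le> \<tau> * \<mu> * (norm (z' - zs))\<^sup>2 + p / 2 * (norm (y - w))\<^sup>2 + 1 / 2 * (norm (z' - y))\<^sup>2" .
  moreover have "0 \<le> (1 - p) * (norm (y - z))\<^sup>2" using p by simp
  ultimately show ?thesis using desc by (simp add: algebra_simps)
qed

section \<open>Measurability and the expected contraction\<close>

definition eg_update ::
  "('a::real_normed_vector \<Rightarrow> ereal) \<Rightarrow> ('a \<Rightarrow> 'a) \<Rightarrow> ('s \<Rightarrow> 'a \<Rightarrow> 'a) \<Rightarrow> real \<Rightarrow> real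
    \<Rightarrow> 's \<times> bool \<Rightarrow> 'a \<times> 'a \<Rightarrow> 'a \<times> 'a" where
  "eg_update g F Fo \<tau> \<alpha> x zw =
     (let z' = eg_next g F \<tau> \<alpha> (Fo (fst x)) (fst zw) (snd zw) in (z', if snd x then z' else snd zw))"

abbreviation eg_path where
  "eg_path g F Fo \<tau> \<alpha> z0 x k \<equiv> eg_vr g F Fo \<tau> \<alpha> z0 (\<lambda>j. fst (x j)) (\<lambda>j. snd (x j)) k"

lemma eg_path_Suc:
  "eg_path g F Fo \<tau> \<alpha> z0 x (Suc k) = eg_update g F Fo \<tau> \<alpha> (x k) (eg_path g F Fo \<tau> \<alpha> z0 x k)"
  by (simp add: eg_update_def split_beta Let_def)

text \<open>
  The state after \<open>k\<close> steps depends only on the first \<open>k\<close> draws; this is what makes it independent of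
  the next one.
\<close>

lemma eg_path_cong:
  "(\<And>j. j < k \<Longrightarrow> x j = x' j) \<Longrightarrow> eg_path g F Fo \<tau> \<alpha> z0 x k = eg_path g F Fo \<tau> \<alpha> z0 x' k"
proof (induction k)
  case (Suc k)
  from Suc.prems have "x k = x' k" by simp
  moreover have "eg_path g F Fo \<tau> \<alpha> z0 x k = eg_path g F Fo \<tau> \<alpha> z0 x' k"
    by (rule Suc.IH) (simp add: Suc.prems)
  ultimately show ?case by (simp only: eg_path_Suc)
qed simp

definition lyapunov :: "real \<Rightarrow> 'a::real_normed_vector \<Rightarrow> 'a \<times> 'a \<Rightarrow> real" where
  "lyapunov p zs zw = (1 - p) * (norm (fst zw - zs))\<^sup>2 + (norm (snd zw - zs))\<^sup>2"

lemma borel_measurable_lyapunov [measurable]: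
  fixes zs :: "'a::euclidean_space"
  shows "lyapunov p zs \<in> borel_measurable (borel \<Otimes>\<^sub>M borel)"
  unfolding lyapunov_def[abs_def] by measurable

locale stochastic_oracle = prob_space Q
  for Q :: "'s measure" and F :: "'a::euclidean_space \<Rightarrow> 'a" and Fo :: "'s \<Rightarrow> 'a \<Rightarrow> 'a" +
  assumes oracle_measurable: "(\<lambda>(s, z). Fo s z) \<in> borel_measurable (Q \<Otimes>\<^sub>M borel)"
    and oracle_integrable: "\<And>z. integrable Q (\<lambda>s. Fo s z)"
    and oracle_unbiased: "\<And>z. F z = (\<integral>s. Fo s z \<partial>Q)"
begin

lemma borel_measurable_mean: "F \<in> borel_measurable borel"
proof -
  have "(\<lambda>(z, s). Fo s z) \<in> borel_measurable (borel \<Otimes>\<^sub>M Q)"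
    using measurable_compose[OF measurable_pair_swap' oracle_measurable]
    by (simp add: case_prod_beta')
  from borel_measurable_lebesgue_integral[OF this]
  show ?thesis by (simp add: oracle_unbiased[abs_def])
qed

end

locale eg_vr_setting = strongly_convex_lsc g \<mu> + stochastic_oracle Q F Fo
  for g :: "'a::euclidean_space \<Rightarrow> ereal" and \<mu> :: real
    and Q :: "'s measure" and F :: "'a \<Rightarrow> 'a" and Fo :: "'s \<Rightarrow> 'a \<Rightarrow> 'a"
begin

lemma measurable_eg_update:
  assumes "\<tau> > 0"
  shows "(\<lambda>(x, zw). eg_update g F Fo \<tau> \<alpha> x zw)
    \<in> (Q \<Otimes>\<^sub>M measure_pmf (bernoulli_pmf q)) \<Otimes>\<^sub>M (borel \<Otimes>\<^sub>M borel) \<rightarrow>\<^sub>M borel \<Otimes>\<^sub>M borel"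
proof -
  note borel_measurable_prox[OF assms, measurable] borel_measurable_mean[measurable]
  have [measurable]: "(\<lambda>v. Fo (f v) (h v)) \<in> borel_measurable N"
    if "f \<in> N \<rightarrow>\<^sub>M Q" "h \<in> borel_measurable N" for f h and N :: "'n measure"
    using measurable_compose[OF measurable_Pair[OF that] oracle_measurable] by simp
  have [measurable]: "Measurable.pred (measure_pmf (bernoulli_pmf q)) (\<lambda>b. b)"
    by simp
  show ?thesis
    unfolding eg_update_def eg_next_def eg_half_def eg_avg_def Let_def case_prod_beta'
    by measurable
qed

text \<open>
  The index set \<open>I\<close> is kept general because the induction step needs the state after \<open>k\<close> steps as a
  function of more than \<open>k\<close> draws.
\<close>

lemma measurable_eg_path:
  assumes "\<tau> > 0" and "{..<k} \<subseteq> I"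
  shows "(\<lambda>x. eg_path g F Fo \<tau> \<alpha> z0 x k)
    \<in> (\<Pi>\<^sub>M i\<in>I. Q \<Otimes>\<^sub>M measure_pmf (bernoulli_pmf q)) \<rightarrow>\<^sub>M borel \<Otimes>\<^sub>M borel"
  using assms(2)
proof (induction k)
  case (Suc k)
  then have [measurable]: "(\<lambda>x. eg_path g F Fo \<tau> \<alpha> z0 x k)
      \<in> (\<Pi>\<^sub>M i\<in>I. Q \<Otimes>\<^sub>M measure_pmf (bernoulli_pmf q)) \<rightarrow>\<^sub>M borel \<Otimes>\<^sub>M borel"
    by (auto simp: lessThan_Suc)
  have [measurable]: "k \<in> I" using Suc.prems by auto
  show ?case
    unfolding eg_path_Suc
    using measurable_compose[OF measurable_Pair measurable_eg_update[OF assms(1)], of "\<lambda>x. x k"]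
    by simp
qed simp

text \<open>
  Taking the mean of the pointwise inequality over the sample. Unbiasedness turns the sampled
  direction into \<open>F y\<close>, whose contribution is nonpositive by monotonicity and the variational
  inequality at \<open>zs\<close>; the mean Lipschitz bound makes the variance at most
  \<open>p / 2 * (norm (y - w))\<^sup>2\<close>. The integral on the left is the nonnegative one, so that square
  integrability of the next state is part of the conclusion.
\<close>

lemma eg_step_expectation:
  assumes \<tau>: "\<tau> > 0" and p: "0 \<le> p" "p \<le> 1"
    and c: "0 \<le> c" "c \<le> 3 * p / 8" "c \<le> \<tau> * \<mu>"
    and vi: "vi_solution F g zs"
    and mono: "\<And>x y. x \<in> edom g \<Longrightarrow> y \<in> edom g \<Longrightarrow> (F x - F y) \<bullet> (x - y) \<ge> 0"
    and sqi: "\<And>u v. integrable Q (\<lambda>s. (norm (Fo s u - Fo s v))\<^sup>2)"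
    and lip: "\<And>u v. (\<integral>s. (norm (Fo s u - Fo s v))\<^sup>2 \<partial>Q) \<le> L\<^sup>2 * (norm (u - v))\<^sup>2"
    and \<tau>L: "4 * \<tau>\<^sup>2 * L\<^sup>2 \<le> p"
  shows "(\<integral>\<^sup>+x. lyapunov p zs (eg_update g F Fo \<tau> (1 - p) x zw)
      \<partial>(Q \<Otimes>\<^sub>M measure_pmf (bernoulli_pmf p))) \<le> ennreal (1 / (1 + c / 3)) * lyapunov p zs zw"
proof -
  obtain z w where zw: "zw = (z, w)" by fastforce
  let ?B = "measure_pmf (bernoulli_pmf p)"
  define y where "y = eg_half g F \<tau> (1 - p) z w"
  define Z where "Z s = eg_next g F \<tau> (1 - p) (Fo s) z w" for s
  have y: "y \<in> edom g" unfolding y_def eg_half_def by (rule prox_in_edom[OF \<tau>])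
  note zs = vi_solution_in_edom[OF vi]
  define rhs where "rhs s = lyapunov p zs zw
        + (2 * \<tau>\<^sup>2 * (norm (Fo s y - Fo s w))\<^sup>2 - p / 2 * (norm (y - w))\<^sup>2)
        + 2 * \<tau> * ((F w + Fo s y - Fo s w) \<bullet> (zs - y) + gr zs - gr y)" for s
  have pointwise: "(1 + c / 3) * ((norm (Z s - zs))\<^sup>2 + (1 - p) * (norm (w - zs))\<^sup>2) \<le> rhs s" for s
    using eg_step_lyapunov[OF \<tau> zs p c, where F = F and H = "Fo s" and z = z and w = w]
    by (simp add: Z_def y_def rhs_def lyapunov_def zw)
  have rhs_int: "integrable Q rhs"
    unfolding rhs_def
    by (intro Bochner_Integration.integrable_add Bochner_Integration.integrable_diff
        integrable_mult_right integrable_inner_left sqi oracle_integrable integrable_const)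
  have "(\<integral>s. rhs s \<partial>Q) = lyapunov p zs zw
        + (2 * \<tau>\<^sup>2 * (\<integral>s. (norm (Fo s y - Fo s w))\<^sup>2 \<partial>Q) - p / 2 * (norm (y - w))\<^sup>2)
        + 2 * \<tau> * (F y \<bullet> (zs - y) + gr zs - gr y)"
    unfolding rhs_def
    by (simp add: sqi oracle_integrable prob_space oracle_unbiased[symmetric])
  also have "\<dots> \<le> lyapunov p zs zw + 0 + 0"
  proof (intro add_mono order_refl)
    have "2 * \<tau>\<^sup>2 * (\<integral>s. (norm (Fo s y - Fo s w))\<^sup>2 \<partial>Q) \<le> 2 * \<tau>\<^sup>2 * (L\<^sup>2 * (norm (y - w))\<^sup>2)"
      by (intro mult_left_mono lip) auto
    also have "\<dots> = (4 * \<tau>\<^sup>2 * L\<^sup>2) / 2 * (norm (y - w))\<^sup>2" by simp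
    also have "\<dots> \<le> p / 2 * (norm (y - w))\<^sup>2"
      using \<tau>L by (intro mult_right_mono divide_right_mono) auto
    finally show "2 * \<tau>\<^sup>2 * (\<integral>s. (norm (Fo s y - Fo s w))\<^sup>2 \<partial>Q) - p / 2 * (norm (y - w))\<^sup>2 \<le> 0"
      by simp
    have "F y \<bullet> (zs - y) + gr zs - gr y \<le> 0"
      using vi_solution_ineq[OF vi y] mono[OF y zs] by (simp add: algebra_simps)
    then show "2 * \<tau> * (F y \<bullet> (zs - y) + gr zs - gr y) \<le> 0"
      using \<tau> by (simp add: mult_le_0_iff)
  qed
  finally have rhs_mean: "(\<integral>s. rhs s \<partial>Q) \<le> lyapunov p zs zw" by simp
  have avg_nonneg: "0 \<le> (norm (Z s - zs))\<^sup>2 + (1 - p) * (norm (w - zs))\<^sup>2" for s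
    using p by simp
  have rhs_nonneg: "0 \<le> rhs s" for s
    by (rule order_trans[OF _ pointwise]) (use avg_nonneg c in auto)
  have coin: "(\<integral>\<^sup>+b. lyapunov p zs (eg_update g F Fo \<tau> (1 - p) (s, b) zw) \<partial>?B)
      = ennreal ((norm (Z s - zs))\<^sup>2 + (1 - p) * (norm (w - zs))\<^sup>2)" for s
    using p
    by (simp add: eg_update_def Let_def zw Z_def[symmetric] lyapunov_def ennreal_mult[symmetric]
        ennreal_plus[symmetric] del: ennreal_plus) (simp add: algebra_simps)
  have meas: "(\<lambda>x. lyapunov p zs (eg_update g F Fo \<tau> (1 - p) x zw)) \<in> borel_measurable (Q \<Otimes>\<^sub>M ?B)"
    using measurable_compose[OF measurable_Pair[OF measurable_ident measurable_const]
        measurable_compose[OF measurable_eg_update[OF \<tau>] borel_measurable_lyapunov], of zw]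
    by (simp add: space_pair_measure)
  have "(\<integral>\<^sup>+x. lyapunov p zs (eg_update g F Fo \<tau> (1 - p) x zw) \<partial>(Q \<Otimes>\<^sub>M ?B))
      = (\<integral>\<^sup>+s. \<integral>\<^sup>+b. lyapunov p zs (eg_update g F Fo \<tau> (1 - p) (s, b) zw) \<partial>?B \<partial>Q)"
    using meas by (subst measure_pmf.nn_integral_fst[symmetric]) simp_all
  also have "\<dots> \<le> (\<integral>\<^sup>+s. ennreal (1 / (1 + c / 3)) * ennreal (rhs s) \<partial>Q)"
  proof (rule nn_integral_mono)
    fix s
    have "(norm (Z s - zs))\<^sup>2 + (1 - p) * (norm (w - zs))\<^sup>2 \<le> 1 / (1 + c / 3) * rhs s"
      using pointwise[of s] c by (simp add: field_simps)
    then show "(\<integral>\<^sup>+b. lyapunov p zs (eg_update g F Fo \<tau> (1 - p) (s, b) zw) \<partial>?B)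
        \<le> ennreal (1 / (1 + c / 3)) * ennreal (rhs s)"
      unfolding coin using c by (simp add: ennreal_mult'[symmetric] ennreal_leI del: times_divide_eq_left)
  qed
  also have "\<dots> = ennreal (1 / (1 + c / 3)) * ennreal (\<integral>s. rhs s \<partial>Q)"
    using rhs_int rhs_nonneg by (simp add: nn_integral_cmult nn_integral_eq_integral)
  also have "\<dots> \<le> ennreal (1 / (1 + c / 3)) * lyapunov p zs zw"
    using rhs_mean by (intro mult_left_mono ennreal_leI) auto
  finally show ?thesis .
qed

text \<open>
  The product measure splits off the last draw, so the one-step bound, which holds for every fixed
  state, can be integrated over the past.
\<close>

lemma eg_path_expectation:
  assumes \<tau>: "\<tau> > 0"
    and step: "\<And>zw. (\<integral>\<^sup>+x. lyapunov p zs (eg_update g F Fo \<tau> \<alpha> x zw)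
        \<partial>(Q \<Otimes>\<^sub>M measure_pmf (bernoulli_pmf q))) \<le> ennreal r * lyapunov p zs zw"
  shows "(\<integral>\<^sup>+x. lyapunov p zs (eg_path g F Fo \<tau> \<alpha> z0 x k)
      \<partial>(\<Pi>\<^sub>M i\<in>{..<k}. Q \<Otimes>\<^sub>M measure_pmf (bernoulli_pmf q))) \<le> ennreal r ^ k * lyapunov p zs (z0, z0)"
proof (induction k)
  case 0
  show ?case by (simp add: PiM_empty nn_integral_count_space_finite)
next
  case (Suc k)
  let ?P = "Q \<Otimes>\<^sub>M measure_pmf (bernoulli_pmf q)"
  interpret pair_prob_space Q "measure_pmf (bernoulli_pmf q)" ..
  interpret product_sigma_finite "\<lambda>_::nat. ?P" ..
  let ?V = "\<lambda>x. ennreal (lyapunov p zs x)"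
  have meas: "(\<lambda>x. ?V (eg_path g F Fo \<tau> \<alpha> z0 x n)) \<in> borel_measurable (\<Pi>\<^sub>M i\<in>{..<n}. ?P)" for n
    using measurable_compose[OF measurable_eg_path[OF \<tau> order_refl] borel_measurable_lyapunov]
    by simp
  have "(\<integral>\<^sup>+x. ?V (eg_path g F Fo \<tau> \<alpha> z0 x (Suc k)) \<partial>(\<Pi>\<^sub>M i\<in>insert k {..<k}. ?P))
      = (\<integral>\<^sup>+x. \<integral>\<^sup>+y. ?V (eg_path g F Fo \<tau> \<alpha> z0 (x(k := y)) (Suc k)) \<partial>?P \<partial>(\<Pi>\<^sub>M i\<in>{..<k}. ?P))"
    using meas[of "Suc k"] by (intro product_nn_integral_insert) (auto simp: lessThan_Suc)
  also have "\<dots> = (\<integral>\<^sup>+x. \<integral>\<^sup>+y. ?V (eg_update g F Fo \<tau> \<alpha> y (eg_path g F Fo \<tau> \<alpha> z0 x k)) \<partial>?P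
      \<partial>(\<Pi>\<^sub>M i\<in>{..<k}. ?P))"
  proof -
    have "eg_path g F Fo \<tau> \<alpha> z0 (x(k := y)) k = eg_path g F Fo \<tau> \<alpha> z0 x k" for x y
      by (rule eg_path_cong) simp
    then show ?thesis by (simp only: eg_path_Suc fun_upd_same)
  qed
  also have "\<dots> \<le> (\<integral>\<^sup>+x. ennreal r * ?V (eg_path g F Fo \<tau> \<alpha> z0 x k) \<partial>(\<Pi>\<^sub>M i\<in>{..<k}. ?P))"
    by (intro nn_integral_mono step)
  also have "\<dots> = ennreal r * (\<integral>\<^sup>+x. ?V (eg_path g F Fo \<tau> \<alpha> z0 x k) \<partial>(\<Pi>\<^sub>M i\<in>{..<k}. ?P))"
    by (rule nn_integral_cmult[OF meas])
  also have "\<dots> \<le> ennreal r * (ennreal r ^ k * ?V (z0, z0))"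
    by (intro mult_left_mono Suc.IH) simp
  finally show ?case by (simp add: lessThan_Suc mult.assoc)
qed

end

text \<open>
  This transfers expectations over \<open>M\<close> of the first \<open>k\<close> draws to a product measure.
\<close>

lemma sampling_distr:
  fixes k :: nat
  assumes "prob_space M" and samp: "sampling M Q p \<xi> b"
  shows "distr M (\<Pi>\<^sub>M i\<in>{..<k}. Q \<Otimes>\<^sub>M measure_pmf (bernoulli_pmf p)) (\<lambda>\<omega>. \<lambda>i\<in>{..<k}. (\<xi> i \<omega>, b i \<omega>))
      = (\<Pi>\<^sub>M i\<in>{..<k}. Q \<Otimes>\<^sub>M measure_pmf (bernoulli_pmf p))"
    and "(\<lambda>\<omega>. \<lambda>i\<in>{..<k}. (\<xi> i \<omega>, b i \<omega>)) \<in> M \<rightarrow>\<^sub>M (\<Pi>\<^sub>M i\<in>{..<k}. Q \<Otimes>\<^sub>M measure_pmf (bernoulli_pmf p))"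
proof -
  interpret M: prob_space M by fact
  let ?P = "Q \<Otimes>\<^sub>M measure_pmf (bernoulli_pmf p)"
  have indep: "M.indep_vars (\<lambda>_. ?P) (\<lambda>k \<omega>. (\<xi> k \<omega>, b k \<omega>)) UNIV"
    and law: "distr M ?P (\<lambda>\<omega>. (\<xi> i \<omega>, b i \<omega>)) = ?P" for i
    using samp by (auto simp: sampling_def)
  have rv: "(\<lambda>\<omega>. (\<xi> i \<omega>, b i \<omega>)) \<in> M \<rightarrow>\<^sub>M ?P" for i
    using indep by (auto simp: M.indep_vars_def)
  then show meas: "(\<lambda>\<omega>. \<lambda>i\<in>{..<k}. (\<xi> i \<omega>, b i \<omega>)) \<in> M \<rightarrow>\<^sub>M (\<Pi>\<^sub>M i\<in>{..<k}. ?P)"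
    by (intro measurable_restrict)
  show "distr M (\<Pi>\<^sub>M i\<in>{..<k}. ?P) (\<lambda>\<omega>. \<lambda>i\<in>{..<k}. (\<xi> i \<omega>, b i \<omega>)) = (\<Pi>\<^sub>M i\<in>{..<k}. ?P)"
  \<comment> \<open>The characterisation of independence by product laws needs a nonempty index set; for \<open>k = 0\<close>
    both sides are the point mass at the empty function.\<close>
  proof (cases "k = 0")
    case True
    show ?thesis
    proof (rule measure_eqI)
      fix A assume "A \<in> sets (distr M (\<Pi>\<^sub>M i\<in>{..<k}. ?P) (\<lambda>\<omega>. \<lambda>i\<in>{..<k}. (\<xi> i \<omega>, b i \<omega>)))"
      then have A: "A \<in> sets (\<Pi>\<^sub>M i\<in>{..<k}. ?P)" by simp
      then have "A = {} \<or> A = {\<lambda>_. undefined}" by (auto simp: True PiM_empty)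
      then show "emeasure (distr M (\<Pi>\<^sub>M i\<in>{..<k}. ?P) (\<lambda>\<omega>. \<lambda>i\<in>{..<k}. (\<xi> i \<omega>, b i \<omega>))) A
          = emeasure (\<Pi>\<^sub>M i\<in>{..<k}. ?P) A"
        using emeasure_distr[OF meas A] M.emeasure_space_1 by (auto simp: True PiM_empty restrict_def)
    qed simp
  next
    case False
    have "M.indep_vars (\<lambda>_. ?P) (\<lambda>k \<omega>. (\<xi> k \<omega>, b k \<omega>)) {..<k}"
      by (rule M.indep_vars_subset[OF indep]) simp
    then show ?thesis
      using False rv by (subst (asm) M.indep_vars_iff_distr_eq_PiM) (auto simp: law)
  qed
qed

section \<open>The linear rate\<close>

lemma integrable_integral_leI:
  fixes f :: "'a \<Rightarrow> real"
  assumes "f \<in> borel_measurable M" "\<And>x. 0 \<le> f x" "(\<integral>\<^sup>+x. f x \<partial>M) \<le> ennreal B" "0 \<le> B"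
  shows "integrable M f \<and> (\<integral>x. f x \<partial>M) \<le> B"
proof
  show int: "integrable M f"
    using assms by (intro integrableI_nonneg) (auto intro: le_less_trans)
  have "ennreal (\<integral>x. f x \<partial>M) \<le> ennreal B"
    using assms by (subst nn_integral_eq_integral[OF int, symmetric]) auto
  then show "(\<integral>x. f x \<partial>M) \<le> B"
    using assms(4) by (simp add: ennreal_le_iff)
qed

theorem theorem4p9:
  fixes g :: "'a::euclidean_space \<Rightarrow> ereal"
    and F :: "'a \<Rightarrow> 'a"
    and Fo :: "'s \<Rightarrow> 'a \<Rightarrow> 'a"
    and Q :: "'s measure"
    and M :: "'w measure"
    and \<xi> :: "nat \<Rightarrow> 'w \<Rightarrow> 's"
    and b :: "nat \<Rightarrow> 'w \<Rightarrow> bool"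
    and L \<mu> p \<alpha> \<tau> c :: real
    and z0 zs :: 'a
    and k :: nat
  assumes g_proper: "proper_fun g"
    and g_convex: "convex_fun g"
    and g_lsc: "lsc_fun g"
    and mu_pos: "\<mu> > 0"
    and g_strong: "strongly_convex_fun \<mu> g"
    and F_mono: "\<And>x y. x \<in> edom g \<Longrightarrow> y \<in> edom g \<Longrightarrow> (F x - F y) \<bullet> (x - y) \<ge> 0"
    and Q_prob: "prob_space Q"
    and Fo_meas: "(\<lambda>(s, z). Fo s z) \<in> borel_measurable (Q \<Otimes>\<^sub>M borel)"
    and Fo_integrable: "\<And>z. integrable Q (\<lambda>s. Fo s z)"
    and Fo_unbiased: "\<And>z. F z = (\<integral>s. Fo s z \<partial>Q)"
    and L_pos: "L > 0"
    and Fo_sq_integrable: "\<And>u v. integrable Q (\<lambda>s. (norm (Fo s u - Fo s v))\<^sup>2)"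
    and Fo_lipschitz: "\<And>u v. (\<integral>s. (norm (Fo s u - Fo s v))\<^sup>2 \<partial>Q) \<le> L\<^sup>2 * (norm (u - v))\<^sup>2"
    and zs: "vi_solution F g zs"
    and M_prob: "prob_space M"
    and samp: "sampling M Q p \<xi> b"
    and p: "p \<in> {0<..<1}"
    and alpha: "\<alpha> = 1 - p"
    and tau: "\<tau> = sqrt p / (2 * L)"
    and c: "c = min (3 * p / 8) (sqrt p * \<mu> / (2 * L))"
  shows "integrable M (\<lambda>\<omega>. (norm (fst (eg_vr g F Fo \<tau> \<alpha> z0 (\<lambda>j. \<xi> j \<omega>) (\<lambda>j. b j \<omega>) k) - zs))\<^sup>2)
    \<and> (\<integral>\<omega>. (norm (fst (eg_vr g F Fo \<tau> \<alpha> z0 (\<lambda>j. \<xi> j \<omega>) (\<lambda>j. b j \<omega>) k) - zs))\<^sup>2 \<partial>M)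
        \<le> (1 / (1 + c / 3)) ^ k * (2 / (1 - p)) * (norm (z0 - zs))\<^sup>2"
proof -
  interpret Q: prob_space Q by (rule Q_prob)
  interpret eg_vr_setting g \<mu> Q F Fo
    using g_proper g_lsc g_strong mu_pos Fo_meas Fo_integrable Fo_unbiased
    by unfold_locales auto
  have \<tau>: "\<tau> > 0" using p L_pos by (simp add: tau)
  have c': "0 \<le> c" "c \<le> 3 * p / 8" "c \<le> \<tau> * \<mu>"
    using p mu_pos L_pos by (auto simp: c tau)
  have \<tau>L: "4 * \<tau>\<^sup>2 * L\<^sup>2 \<le> p"
    using p L_pos by (simp add: tau power_divide power_mult_distrib)
  let ?r = "1 / (1 + c / 3)"
  let ?P = "Q \<Otimes>\<^sub>M measure_pmf (bernoulli_pmf p)"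
  let ?X = "\<lambda>\<omega>. \<lambda>i\<in>{..<k}. (\<xi> i \<omega>, b i \<omega>)"
  let ?zw = "\<lambda>x. eg_path g F Fo \<tau> \<alpha> z0 x k"
  let ?f = "\<lambda>\<omega>. (norm (fst (eg_vr g F Fo \<tau> \<alpha> z0 (\<lambda>j. \<xi> j \<omega>) (\<lambda>j. b j \<omega>) k) - zs))\<^sup>2"
  note X [measurable] = sampling_distr(2)[OF M_prob samp, of k]
  note path [measurable] = measurable_eg_path[OF \<tau> order_refl, where k = k and \<alpha> = \<alpha> and ?z0.0 = z0 and q = p]
  have path_eq: "eg_vr g F Fo \<tau> \<alpha> z0 (\<lambda>j. \<xi> j \<omega>) (\<lambda>j. b j \<omega>) k = ?zw (?X \<omega>)" for \<omega>
    using eg_path_cong[of k "?X \<omega>" "\<lambda>i. (\<xi> i \<omega>, b i \<omega>)" g F Fo \<tau> \<alpha> z0] by simp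
  have f_meas: "?f \<in> borel_measurable M"
    unfolding path_eq by measurable
  have "(\<integral>\<^sup>+\<omega>. lyapunov p zs (?zw (?X \<omega>)) \<partial>M)
      = (\<integral>\<^sup>+x. lyapunov p zs (?zw x) \<partial>(\<Pi>\<^sub>M i\<in>{..<k}. ?P))"
    by (subst sampling_distr(1)[OF M_prob samp, symmetric]) (subst nn_integral_distr, simp_all)
  also have "\<dots> \<le> ennreal ?r ^ k * lyapunov p zs (z0, z0)"
    unfolding alpha using p
    by (intro eg_path_expectation[OF \<tau> eg_step_expectation[OF \<tau> _ _ c' zs F_mono
          Fo_sq_integrable Fo_lipschitz \<tau>L]]) auto
  finally have lyap: "(\<integral>\<^sup>+\<omega>. lyapunov p zs (?zw (?X \<omega>)) \<partial>M) \<le> ennreal ?r ^ k * lyapunov p zs (z0, z0)" .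
  \<comment> \<open>The first summand of the Lyapunov function is \<open>1 - p\<close> times the squared error, whence the
    factor \<open>1 / (1 - p)\<close>; the other factor \<open>2\<close> bounds \<open>2 - p\<close>, its initial weight.\<close>
  have "(\<integral>\<^sup>+\<omega>. ?f \<omega> \<partial>M) \<le> (\<integral>\<^sup>+\<omega>. ennreal (1 / (1 - p)) * lyapunov p zs (?zw (?X \<omega>)) \<partial>M)"
  proof (rule nn_integral_mono)
    fix \<omega>
    have "?f \<omega> \<le> 1 / (1 - p) * lyapunov p zs (?zw (?X \<omega>))"
      using p by (simp add: path_eq lyapunov_def field_simps)
    then show "ennreal (?f \<omega>) \<le> ennreal (1 / (1 - p)) * lyapunov p zs (?zw (?X \<omega>))"
      using p by (simp add: ennreal_mult'[symmetric] ennreal_leI del: times_divide_eq_left)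
  qed
  also have "\<dots> = ennreal (1 / (1 - p)) * (\<integral>\<^sup>+\<omega>. lyapunov p zs (?zw (?X \<omega>)) \<partial>M)"
    by (rule nn_integral_cmult) measurable
  also have "\<dots> \<le> ennreal (1 / (1 - p)) * (ennreal ?r ^ k * lyapunov p zs (z0, z0))"
    by (intro mult_left_mono lyap) simp
  also have "\<dots> = ennreal (1 / (1 - p) * (?r ^ k * lyapunov p zs (z0, z0)))"
  proof -
    have "0 \<le> 1 / (1 - p)" "0 \<le> ?r" using p c' by auto
    then show ?thesis by (simp only: ennreal_mult' ennreal_power zero_le_power)
  qed
  also have "\<dots> \<le> ennreal (?r ^ k * (2 / (1 - p)) * (norm (z0 - zs))\<^sup>2)"
  proof (rule ennreal_leI)
    have "lyapunov p zs (z0, z0) \<le> 2 * (norm (z0 - zs))\<^sup>2"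
      using p mult_right_mono[of "1 - p" 1 "(norm (z0 - zs))\<^sup>2"] by (simp add: lyapunov_def)
    then have "1 / (1 - p) * (?r ^ k * lyapunov p zs (z0, z0))
        \<le> 1 / (1 - p) * (?r ^ k * (2 * (norm (z0 - zs))\<^sup>2))"
      using p c' by (intro mult_left_mono) auto
    then show "1 / (1 - p) * (?r ^ k * lyapunov p zs (z0, z0))
        \<le> ?r ^ k * (2 / (1 - p)) * (norm (z0 - zs))\<^sup>2"
      by (simp add: mult_ac)
  qed
  finally show ?thesis
    using p c' by (intro integrable_integral_leI[OF f_meas]) auto
qed

end
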